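(* Let $k$ be a field of characteristic zero and let $(A,0,P)$ be a Rota-Baxter algebra of weight $\lambda=0$ over $k$, i.e. $A$ is an associative $k$-algebra and $P:A\to A$ is a $k$-linear map with $P(x)P(y)=P(xP(y))+P(P(x)y)$ for all $x,y\in A$. For integers $a,b,c\ge 0$ let $T(a,b,c):A\otimes A\to A$ be the operator $T(a,b,c)(x\otimes y)=P^{c}\big(P^{a}(x)\,P^{b}(y)\big)$, where $P^0$ is the identity. Then for all integers $a,b>1$ and $c\ge 0$, \[T(a,b,c)=\sum_{i=1}^{b}\binom{a-1+b-i}{a-1}T(0,i,a+b+c-i)+\sum_{i=1}^{a}\binom{b-1+a-i}{b-1}T(i,0,a+b+c-i).\]
   Context: A Rota-Baxter algebra is a triple $(A,\lambda,P)$ with $A$ an associative $k$-algebra, $\lambda\in k$, and $P:A\to A$ a $k$-linear operator satisfying $P(x)P(y)=P(xP(y))+P(P(x)y)+\lambda P(xy)$ for all $x,y\in A$. *)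

theory Defs
  imports Complex_Main "HOL-Library.Poly_Mapping"
begin

text \<open>Associative algebras over a field; a unit element is not required.\<close>

locale assoc_algebra = vector_space scale
  for scale :: "'k::field \<Rightarrow> 'a::ring \<Rightarrow> 'a" +
  assumes scale_mult_left: "scale c x * y = scale c (x * y)"
    and scale_mult_right: "x * scale c y = scale c (x * y)"

locale rota_baxter_algebra = assoc_algebra scale
  for scale :: "'k::field \<Rightarrow> 'a::ring \<Rightarrow> 'a" +
  fixes weight :: 'k and P :: "'a \<Rightarrow> 'a"
  assumes linear_P: "Vector_Spaces.linear scale scale P"
    and rota_baxter:
      "P x * P y = P (x * P y) + P (P x * y) + scale weight (P (x * y))"

text \<open>
  The tensor product of two \<open>k\<close>-vector spaces is the quotient of the free vector space on
  pairs by the span of the bilinearity relators. Its elements are the cosets, and since the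
  relators depend on the scalar multiplications (which are not part of the types), the
  tensor product is a set of cosets and not a type of its own.
\<close>

definition free_scale :: "'k::field \<Rightarrow> ('i \<Rightarrow>\<^sub>0 'k) \<Rightarrow> ('i \<Rightarrow>\<^sub>0 'k)" where
  "free_scale c u = Poly_Mapping.map ((*) c) u"

lemma lookup_free_scale [simp]: "Poly_Mapping.lookup (free_scale c u) i = c * Poly_Mapping.lookup u i"
  by (simp add: free_scale_def map.rep_eq when_def)

interpretation free: vector_space free_scale
  by unfold_locales
    (rule poly_mapping_eqI; simp add: lookup_add algebra_simps)+

definition tensor_relators ::
  "('k::field \<Rightarrow> 'a::ab_group_add \<Rightarrow> 'a) \<Rightarrow> ('k \<Rightarrow> 'b::ab_group_add \<Rightarrow> 'b)
    \<Rightarrow> ('a \<times> 'b \<Rightarrow>\<^sub>0 'k) set" where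
  "tensor_relators sA sB =
     {Poly_Mapping.single (x + x', y) 1
        - Poly_Mapping.single (x, y) 1 - Poly_Mapping.single (x', y) 1 | x x' y. True}
   \<union> {Poly_Mapping.single (x, y + y') 1
        - Poly_Mapping.single (x, y) 1 - Poly_Mapping.single (x, y') 1 | x y y'. True}
   \<union> {Poly_Mapping.single (sA c x, y) 1
        - free_scale c (Poly_Mapping.single (x, y) 1) | c x y. True}
   \<union> {Poly_Mapping.single (x, sB c y) 1
        - free_scale c (Poly_Mapping.single (x, y) 1) | c x y. True}"

definition tensor_rel ::
  "('k::field \<Rightarrow> 'a::ab_group_add \<Rightarrow> 'a) \<Rightarrow> ('k \<Rightarrow> 'b::ab_group_add \<Rightarrow> 'b)
    \<Rightarrow> (('a \<times> 'b \<Rightarrow>\<^sub>0 'k) \<times> ('a \<times> 'b \<Rightarrow>\<^sub>0 'k)) set" where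
  "tensor_rel sA sB = {(u, v). u - v \<in> free.span (tensor_relators sA sB)}"

definition tensor_space ::
  "('k::field \<Rightarrow> 'a::ab_group_add \<Rightarrow> 'a) \<Rightarrow> ('k \<Rightarrow> 'b::ab_group_add \<Rightarrow> 'b)
    \<Rightarrow> ('a \<times> 'b \<Rightarrow>\<^sub>0 'k) set set" where
  "tensor_space sA sB = UNIV // tensor_rel sA sB"

definition pure_tensor ::
  "('k::field \<Rightarrow> 'a::ab_group_add \<Rightarrow> 'a) \<Rightarrow> ('k \<Rightarrow> 'b::ab_group_add \<Rightarrow> 'b)
    \<Rightarrow> 'a \<Rightarrow> 'b \<Rightarrow> ('a \<times> 'b \<Rightarrow>\<^sub>0 'k) set" where
  "pure_tensor sA sB x y = tensor_rel sA sB `` {Poly_Mapping.single (x, y) 1}"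

lemma equiv_tensor_rel: "equiv UNIV (tensor_rel sA sB)"
proof (rule equivI)
  show "refl (tensor_rel sA sB)"
    by (simp add: refl_on_def tensor_rel_def free.span_zero)
  show "sym (tensor_rel sA sB)"
    unfolding sym_def tensor_rel_def using free.span_neg by fastforce
  show "trans (tensor_rel sA sB)"
    unfolding trans_def tensor_rel_def using free.span_add by fastforce
qed simp

definition free_lift ::
  "('k::field \<Rightarrow> 'c::ab_group_add \<Rightarrow> 'c) \<Rightarrow> ('a \<Rightarrow> 'b \<Rightarrow> 'c) \<Rightarrow> ('a \<times> 'b \<Rightarrow>\<^sub>0 'k) \<Rightarrow> 'c" where
  "free_lift sC f u = (\<Sum>(x, y) \<in> Poly_Mapping.keys u. sC (Poly_Mapping.lookup u (x, y)) (f x y))"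

text \<open>
  The linear map on the tensor product induced by a bilinear map \<open>f\<close>: the linear extension
  of \<open>f\<close> to the free vector space is constant on every coset, and this constant is the
  value. It is meaningful only for bilinear \<open>f\<close> (see \<open>tensor_lift_class\<close> below).
\<close>

definition tensor_lift ::
  "('k::field \<Rightarrow> 'c::ab_group_add \<Rightarrow> 'c) \<Rightarrow> ('a \<Rightarrow> 'b \<Rightarrow> 'c)
    \<Rightarrow> ('a \<times> 'b \<Rightarrow>\<^sub>0 'k) set \<Rightarrow> 'c" where
  "tensor_lift sC f t = the_elem (free_lift sC f ` t)"

lemma free_lift_superset:
  assumes "vector_space sC" and "finite S" and "Poly_Mapping.keys u \<subseteq> S"
  shows "free_lift sC f u = (\<Sum>(x, y) \<in> S. sC (Poly_Mapping.lookup u (x, y)) (f x y))"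
proof -
  interpret vector_space sC by fact
  show ?thesis
    unfolding free_lift_def
    by (rule sum.mono_neutral_left) (use assms in \<open>auto simp: in_keys_iff\<close>)
qed

lemma linear_free_lift:
  fixes sC :: "'k::field \<Rightarrow> 'c::ab_group_add \<Rightarrow> 'c"
  assumes "vector_space sC"
  shows "Vector_Spaces.linear free_scale sC (free_lift sC f)"
proof -
  interpret C: vector_space sC by fact
  show ?thesis
    unfolding Vector_Spaces.linear_iff
  proof (intro conjI allI free.vector_space_axioms assms)
    fix u v :: "'a \<times> 'b \<Rightarrow>\<^sub>0 'k"
    have "Poly_Mapping.keys (u + v) \<subseteq> Poly_Mapping.keys u \<union> Poly_Mapping.keys v"
      by (rule Poly_Mapping.keys_add)
    then show "free_lift sC f (u + v) = free_lift sC f u + free_lift sC f v"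
      by (simp add: free_lift_superset[OF assms, of "Poly_Mapping.keys u \<union> Poly_Mapping.keys v"])
        (simp add: lookup_add C.scale_left_distrib sum.distrib case_prod_beta)
  next
    fix c and u :: "'a \<times> 'b \<Rightarrow>\<^sub>0 'k"
    have "Poly_Mapping.keys (free_scale c u) \<subseteq> Poly_Mapping.keys u"
      by (auto simp: in_keys_iff)
    then show "free_lift sC f (free_scale c u) = sC c (free_lift sC f u)"
      by (simp add: free_lift_superset[OF assms, of "Poly_Mapping.keys u"])
        (simp add: C.scale_sum_right case_prod_beta)
  qed
qed

lemma free_lift_single:
  assumes "vector_space sC"
  shows "free_lift sC f (Poly_Mapping.single (x, y) 1) = f x y"
proof -
  interpret vector_space sC by fact
  show ?thesis
    by (simp add: free_lift_def)
qed

lemma tensor_lift_class: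
  fixes sA :: "'k::field \<Rightarrow> 'a::ab_group_add \<Rightarrow> 'a"
    and sB :: "'k \<Rightarrow> 'b::ab_group_add \<Rightarrow> 'b"
    and sC :: "'k \<Rightarrow> 'c::ab_group_add \<Rightarrow> 'c"
  assumes lin1: "\<And>y. Vector_Spaces.linear sA sC (\<lambda>x. f x y)"
    and lin2: "\<And>x. Vector_Spaces.linear sB sC (f x)"
  shows "tensor_lift sC f (tensor_rel sA sB `` {u}) = free_lift sC f u"
proof -
  have C: "vector_space sC"
    using lin1[of 0] by (simp add: Vector_Spaces.linear_def)
  interpret L: Vector_Spaces.linear free_scale sC "free_lift sC f"
    by (rule linear_free_lift[OF C])
  have bilinear:
    "f (x + x') y = f x y + f x' y" "f x (y + y') = f x y + f x y'"
    "f (sA c x) y = sC c (f x y)" "f x (sB c y) = sC c (f x y)" for x x' y y' c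
    using lin1[of y] lin2[of x] by (simp_all add: Vector_Spaces.linear_iff)
  have rel0: "free_lift sC f r = 0" if "r \<in> tensor_relators sA sB" for r
    using that unfolding tensor_relators_def
    by (elim UnE CollectE exE conjE)
      (simp_all only: L.diff L.scale free_lift_single[OF C] bilinear, simp_all)
  have span0: "free_lift sC f r = 0" if "r \<in> free.span (tensor_relators sA sB)" for r
    using that rel0 by (rule L.eq_0_on_span[rotated])
  have "free_lift sC f v = free_lift sC f u" if "(u, v) \<in> tensor_rel sA sB" for v
    using span0[of "u - v"] that by (simp add: tensor_rel_def L.diff)
  moreover have "(u, u) \<in> tensor_rel sA sB"
    by (simp add: tensor_rel_def free.span_zero)
  ultimately have "free_lift sC f ` (tensor_rel sA sB `` {u}) = {free_lift sC f u}"
    by blast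
  then show ?thesis
    by (simp add: tensor_lift_def)
qed

definition rb_T ::
  "('k::field \<Rightarrow> 'a::ring \<Rightarrow> 'a) \<Rightarrow> ('a \<Rightarrow> 'a) \<Rightarrow> nat \<Rightarrow> nat \<Rightarrow> nat
    \<Rightarrow> ('a \<times> 'a \<Rightarrow>\<^sub>0 'k) set \<Rightarrow> 'a" where
  "rb_T scale P a b c =
     tensor_lift scale (\<lambda>x y. (P ^^ c) ((P ^^ a) x * (P ^^ b) y))"

context rota_baxter_algebra
begin

lemma linear_funpow: "Vector_Spaces.linear scale scale (P ^^ n)"
  using linear_P by (induction n) (simp_all add: Vector_Spaces.linear_iff)

lemma rb_T_class:
  "rb_T scale P a b c (tensor_rel scale scale `` {u}) =
     free_lift scale (\<lambda>x y. (P ^^ c) ((P ^^ a) x * (P ^^ b) y)) u"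
proof -
  interpret pow: Vector_Spaces.linear scale scale "P ^^ n" for n
    by (rule linear_funpow)
  show ?thesis
    unfolding rb_T_def
    by (rule tensor_lift_class)
      (simp_all add: Vector_Spaces.linear_iff vector_space_axioms pow.add pow.scale
        distrib_left distrib_right
        scale_mult_left scale_mult_right)
qed

lemma rb_T_pure_tensor:
  "rb_T scale P a b c (pure_tensor scale scale x y) = (P ^^ c) ((P ^^ a) x * (P ^^ b) y)"
  by (simp add: pure_tensor_def rb_T_class free_lift_single[OF vector_space_axioms])

end

end

theory Submission
  imports Defs
begin

text \<open>
  The Rota--Baxter identity of weight zero gives
  \<open>T(a+1,b+1,c) = T(a,b+1,c+1) + T(a+1,b,c+1)\<close>. Unfolding this recursion follows lattice paths
  from \<open>(a,b)\<close> to the coordinate axes, and the path ends when it first reaches an axis. The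
  coefficient of \<open>T(0,i,_)\<close> counts the paths ending at \<open>(0,i)\<close>: their last step is from
  \<open>(1,i)\<close>, which leaves \<open>a-1\<close> horizontal and \<open>b-i\<close> vertical steps in arbitrary order.
\<close>

text \<open>
  Writing the number of paths as \<open>(m + d - 1) choose d\<close> with \<open>d = n - i\<close> instead of
  \<open>(m + d - 1) choose (m - 1)\<close> gives the right value also for \<open>m = 0\<close>, where truncated
  subtraction makes it 1 for \<open>d = 0\<close> and 0 otherwise.
\<close>

definition path_sum ::
  "('k::field \<Rightarrow> 'v::ab_group_add \<Rightarrow> 'v) \<Rightarrow> (nat \<Rightarrow> nat \<Rightarrow> 'v) \<Rightarrow> nat \<Rightarrow> nat \<Rightarrow> nat \<Rightarrow> 'v" where
  "path_sum scale g m n c =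
     (\<Sum>i = 1..n. scale (of_nat ((m + (n - i) - 1) choose (n - i))) (g i (m + n + c - i)))"

context vector_space
begin

lemma path_sum_right_0 [simp]: "path_sum scale g m 0 c = 0"
  by (simp add: path_sum_def)

lemma path_sum_left_0:
  assumes "n > 0"
  shows "path_sum scale g 0 n c = g n c"
proof -
  have "path_sum scale g 0 n c = (\<Sum>i = 1..n. if i = n then g n c else 0)"
    unfolding path_sum_def by (rule sum.cong) (auto simp: binomial_eq_0)
  with assms show ?thesis
    by simp
qed

text \<open>Splitting the paths to a fixed endpoint by their first step amounts to Pascal's rule for
  the coefficients.\<close>

lemma path_sum_Suc_Suc:
  "path_sum scale g (Suc m) (Suc n) c = path_sum scale g m (Suc n) (Suc c) + path_sum scale g (Suc m) n (Suc c)"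
proof -
  have pascal: "(m + (Suc n - i)) choose (Suc n - i) =
      (m + (Suc n - i) - 1 choose (Suc n - i)) + (m + (n - i) choose (n - i))"
    if "i \<in> {1..n}" for i
    using that by (simp add: Suc_diff_le)
  \<comment> \<open>The term \<open>i = Suc n\<close> is set apart: its coefficient is 1, and on the
    right only the first \<open>path_sum\<close> has such a term.\<close>
  have "path_sum scale g (Suc m) (Suc n) c =
      (\<Sum>i = 1..n. scale (of_nat ((m + (Suc n - i)) choose (Suc n - i))) (g i (m + Suc n + Suc c - i)))
        + g (Suc n) (m + Suc c)"
    by (simp add: path_sum_def)
  also have "(\<Sum>i = 1..n. scale (of_nat ((m + (Suc n - i)) choose (Suc n - i))) (g i (m + Suc n + Suc c - i)))
      = (\<Sum>i = 1..n. scale (of_nat ((m + (Suc n - i) - 1) choose (Suc n - i))) (g i (m + Suc n + Suc c - i)))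
        + path_sum scale g (Suc m) n (Suc c)"
    unfolding path_sum_def sum.distrib[symmetric]
  proof (rule sum.cong[OF refl])
    fix i assume "i \<in> {1..n}"
    then show "scale (of_nat ((m + (Suc n - i)) choose (Suc n - i))) (g i (m + Suc n + Suc c - i)) =
      scale (of_nat ((m + (Suc n - i) - 1) choose (Suc n - i))) (g i (m + Suc n + Suc c - i))
      + scale (of_nat ((Suc m + (n - i) - 1) choose (n - i))) (g i (Suc m + n + Suc c - i))"
      unfolding pascal[OF \<open>i \<in> {1..n}\<close>] by (simp add: scale_left_distrib)
  qed
  finally show ?thesis
    by (simp add: path_sum_def add_ac)
qed

text \<open>Both sides obey the same recursion, and on an axis one sum is empty while the other
  collapses to \<open>f m n c\<close>. At the origin both are empty, hence
  \<open>m + n > 0\<close>.\<close>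

lemma lattice_recurrence_solution:
  assumes rec: "\<And>m n c. f (Suc m) (Suc n) c = f m (Suc n) (Suc c) + f (Suc m) n (Suc c)"
    and "m + n > 0"
  shows "f m n c = path_sum scale (f 0) m n c + path_sum scale (\<lambda>i. f i 0) n m c"
  using \<open>m + n > 0\<close>
proof (induction "m + n" arbitrary: m n c rule: less_induct)
  case less
  show ?case
  proof (cases m)
    case 0
    with less.prems show ?thesis
      by (simp add: path_sum_left_0)
  next
    case m: (Suc m')
    show ?thesis
    proof (cases n)
      case 0
      with less.prems show ?thesis
        by (simp add: path_sum_left_0)
    next
      case n: (Suc n')
      show ?thesis
        using less.hyps[of m' n "Suc c"] less.hyps[of m n' "Suc c"]
        by (simp add: m n rec path_sum_Suc_Suc add_ac)
    qed
  qed
qed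

end

lemma (in rota_baxter_algebra) rb_T_Suc_Suc:
  assumes "weight = 0" and "t \<in> tensor_space scale scale"
  shows "rb_T scale P (Suc a) (Suc b) c t =
    rb_T scale P a (Suc b) (Suc c) t + rb_T scale P (Suc a) b (Suc c) t"
proof -
  interpret pow: Vector_Spaces.linear scale scale "P ^^ n" for n
    by (rule linear_funpow)
  \<comment> \<open>On the class of \<open>u\<close> each operator is a sum over the keys of
    \<open>u\<close>, so an identity for all pairs \<open>x\<close>, \<open>y\<close>
    suffices.\<close>
  obtain u where t: "t = tensor_rel scale scale `` {u}"
    using assms(2) by (auto simp: tensor_space_def quotient_def)
  have "(P ^^ c) ((P ^^ Suc a) x * (P ^^ Suc b) y) =
      (P ^^ Suc c) ((P ^^ a) x * (P ^^ Suc b) y) + (P ^^ Suc c) ((P ^^ Suc a) x * (P ^^ b) y)" for x y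
    using rota_baxter[of "(P ^^ a) x" "(P ^^ b) y"] assms(1)
    by (simp add: pow.add funpow_swap1[symmetric])
  then show ?thesis
    unfolding t rb_T_class free_lift_def
    by (auto simp only: scale_right_distrib sum.distrib[symmetric] split_beta fst_conv snd_conv intro!: sum.cong)
qed

theorem theorem1:
  fixes scale :: "'k::field_char_0 \<Rightarrow> 'a::ring \<Rightarrow> 'a"
    and P :: "'a \<Rightarrow> 'a"
    and a b c :: nat
  assumes "rota_baxter_algebra scale 0 P"
    and "a > 1" and "b > 1"
  shows "\<forall>t \<in> tensor_space scale scale.
    rb_T scale P a b c t =
      (\<Sum>i = 1..b. scale (of_nat ((a - 1 + b - i) choose (a - 1))) (rb_T scale P 0 i (a + b + c - i) t))
    + (\<Sum>i = 1..a. scale (of_nat ((b - 1 + a - i) choose (b - 1))) (rb_T scale P i 0 (a + b + c - i) t))"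
proof
  fix t assume t: "t \<in> tensor_space scale scale"
  interpret rota_baxter_algebra scale 0 P by fact
  \<comment> \<open>The lower indices \<open>n - i\<close> and \<open>m - 1\<close> add up to the
    upper one, so symmetry of binomials converts the path counts.\<close>
  have binomial: "(m + (n - i) - 1) choose (n - i) = (m - 1 + n - i) choose (m - 1)"
    if "i \<in> {1..n}" "m > 1" for m n i :: nat
    using that binomial_symmetric[of "n - i" "m - 1 + n - i"] by simp
  have "rb_T scale P a b c t =
      path_sum scale (\<lambda>i k. rb_T scale P 0 i k t) a b c + path_sum scale (\<lambda>i k. rb_T scale P i 0 k t) b a c"
    using lattice_recurrence_solution[of "\<lambda>a b c. rb_T scale P a b c t" a b c]
      rb_T_Suc_Suc[OF refl t] \<open>a > 1\<close> by simp
  then show "rb_T scale P a b c t =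
      (\<Sum>i = 1..b. scale (of_nat ((a - 1 + b - i) choose (a - 1))) (rb_T scale P 0 i (a + b + c - i) t))
    + (\<Sum>i = 1..a. scale (of_nat ((b - 1 + a - i) choose (b - 1))) (rb_T scale P i 0 (a + b + c - i) t))"
    unfolding path_sum_def
    using \<open>a > 1\<close> \<open>b > 1\<close> by (simp only: binomial add.commute[of b a] cong: sum.cong)
qed

end
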